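(* Let $d\ge 3$ be an integer and let $F^1_d=(X_0^d+X_1^d+X_2^d=0)\subset\mathbb{P}^2_{\mathbb{C}}$. The correspondence between cocycles and real forms of $F^1_d$ is the following: (i) the real form corresponding to the cocycle $K^{0,3}_1$ (or $H^3_1$) is $(Y_0^d+Y_1^d+Y_2^d=0)\subset\mathbb{P}^2_{\mathbb{R}}$; (ii) the real form corresponding to the cocycle $K^{1,2}_1$ is $(-Y_0^d+Y_1^d+Y_2^d=0)\subset\mathbb{P}^2_{\mathbb{R}}$; (iii) the real form corresponding to the cocycle $K^{0,1}_1$ (or $H^1_1$) is $(Y_0^d+(Y_1+\sqrt{-1}\,Y_2)^d+(Y_1-\sqrt{-1}\,Y_2)^d=0)\subset\mathbb{P}^2_{\mathbb{R}}$.
   Context: Let $\xi$ be a primitive $d$-th root of unity in $\mathbb{C}$. Let $\rho$ be the real structure on $F^1_d$ given by complex conjugation $[z_0:z_1:z_2]\mapsto[\overline{z_0}:\overline{z_1}:\overline{z_2}]$. A cocycle is an automorphism $\alpha\in\operatorname{Aut}_{\mathbb{C}}F^1_d$ with $(\alpha\circ\rho)^2=\mathrm{id}$; the real form corresponding to $\alpha$ is the quotient of $F^1_d$ by the real structure $\alpha\circ\rho$, i.e. the real variety (unique up to $\mathbb{R}$-isomorphism) whose complexification is isomorphic to $F^1_d$ with complex conjugation corresponding to $\alpha\circ\rho$. Matrices denote the linear automorphisms of $F^1_d$ they induce on homogeneous coordinates. Here $$K^{0,3}_1=H^3_1=I_3,\qquad K^{1,2}_1=\begin{pmatrix}\xi&0&0\\0&1&0\\0&0&1\end{pmatrix},\qquad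 K^{0,1}_1=H^1_1=\begin{pmatrix}1&0&0\\0&0&1\\0&1&0\end{pmatrix}.$$ (The notation $K$ is used by the paper for even $d$ and the notation $H$ for odd $d$.) The equation in (iii) has real coefficients once expanded. *)

theory Defs
  imports
    "HOL-Analysis.Analysis"
    "HOL-Library.Poly_Mapping"
    "HOL-Computational_Algebra.Squarefree"
begin

text \<open>
  Homogeneous coordinates \<open>z\<^sub>0, z\<^sub>1, z\<^sub>2\<close> are the components \<open>1, 2, 3\<close> of a vector
  of type \<open>complex^3\<close>, following the indexing of \<^const>\<open>vector\<close>; likewise the variables
  \<open>Y\<^sub>0, Y\<^sub>1, Y\<^sub>2\<close> are indexed by \<open>1, 2, 3\<close>.
\<close>

section \<open>Polynomials in three variables\<close>

type_synonym cpoly3 = "(3 \<Rightarrow>\<^sub>0 nat) \<Rightarrow>\<^sub>0 complex"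

definition pvar :: "3 \<Rightarrow> cpoly3" where
  "pvar i = Poly_Mapping.single (Poly_Mapping.single i 1) 1"

definition pconst :: "complex \<Rightarrow> cpoly3" where
  "pconst c = Poly_Mapping.single 0 c"

abbreviation Y0 :: cpoly3 where "Y0 \<equiv> pvar 1"
abbreviation Y1 :: cpoly3 where "Y1 \<equiv> pvar 2"
abbreviation Y2 :: cpoly3 where "Y2 \<equiv> pvar 3"

definition peval :: "cpoly3 \<Rightarrow> complex^3 \<Rightarrow> complex" where
  "peval p v =
     (\<Sum>m\<in>Poly_Mapping.keys p.
        Poly_Mapping.lookup p m * (\<Prod>i\<in>UNIV. (v $ i) ^ Poly_Mapping.lookup m i))"

definition homogeneous :: "nat \<Rightarrow> cpoly3 \<Rightarrow> bool" where
  "homogeneous k p \<longleftrightarrow>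
     (\<forall>m\<in>Poly_Mapping.keys p. (\<Sum>i\<in>UNIV. Poly_Mapping.lookup m i) = k)"

definition real_coeffs :: "cpoly3 \<Rightarrow> bool" where
  "real_coeffs p \<longleftrightarrow> (\<forall>m. Poly_Mapping.lookup p m \<in> \<real>)"

section \<open>The complex projective plane\<close>

definition proj_rel :: "complex^3 \<Rightarrow> complex^3 \<Rightarrow> bool" where
  "proj_rel u v \<longleftrightarrow> u \<noteq> 0 \<and> v \<noteq> 0 \<and> (\<exists>c. c \<noteq> 0 \<and> v = c *s u)"

lemma part_equivp_proj_rel: "part_equivp proj_rel"
proof (rule part_equivpI)
  show "\<exists>x. proj_rel x x"
    by (rule exI[of _ "axis 1 1"]) (auto simp: proj_rel_def axis_eq_0_iff intro!: exI[of _ 1])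
  show "symp proj_rel"
  proof (rule sympI)
    fix u v assume "proj_rel u v"
    then obtain c where "u \<noteq> 0" "v \<noteq> 0" "c \<noteq> 0" "v = c *s u"
      by (auto simp: proj_rel_def)
    then show "proj_rel v u"
      by (auto simp: proj_rel_def vector_smult_assoc intro!: exI[of _ "inverse c"])
  qed
  show "transp proj_rel"
  proof (rule transpI)
    fix u v w assume "proj_rel u v" "proj_rel v w"
    then obtain c e where "u \<noteq> 0" "w \<noteq> 0" "c \<noteq> 0" "e \<noteq> 0" "v = c *s u" "w = e *s v"
      by (auto simp: proj_rel_def)
    then show "proj_rel u w"
      by (auto simp: proj_rel_def vector_smult_assoc intro!: exI[of _ "e * c"])
  qed
qed

quotient_type cp2 = "complex^3" / partial: proj_rel
  by (rule part_equivp_proj_rel)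

lift_definition conj_cp2 :: "cp2 \<Rightarrow> cp2" is "\<lambda>v. \<chi> i. cnj (v $ i)"
proof -
  fix u v assume "proj_rel u v"
  then obtain c where "u \<noteq> 0" "v \<noteq> 0" "c \<noteq> 0" "v = c *s u"
    by (auto simp: proj_rel_def)
  then show "proj_rel (\<chi> i. cnj (u $ i)) (\<chi> i. cnj (v $ i))"
    by (auto simp: proj_rel_def vec_eq_iff intro!: exI[of _ "cnj c"])
qed

text \<open>
  The map induced by a matrix on homogeneous coordinates.  It is independent of the chosen
  representative, and hence meaningful, when \<open>A\<close> is invertible.
\<close>

definition linear_cp2 :: "complex^3^3 \<Rightarrow> cp2 \<Rightarrow> cp2" where
  "linear_cp2 A p = abs_cp2 (A *v rep_cp2 p)"

section \<open>Projective plane curves and their morphisms\<close>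

text \<open>To be applied to homogeneous polynomials only.\<close>

definition zero_locus :: "cpoly3 \<Rightarrow> cp2 set" where
  "zero_locus G = {p. peval G (rep_cp2 p) = 0}"

definition peval_tuple :: "(3 \<Rightarrow> cpoly3) \<Rightarrow> complex^3 \<Rightarrow> complex^3" where
  "peval_tuple P v = (\<chi> i. peval (P i) v)"

text \<open>
  A map is regular on \<open>V\<close> if near every point of \<open>V\<close> it is given by a triple of homogeneous
  polynomials of equal degree without common zero at the point.  It suffices to ask for triples
  that represent the map wherever they do not vanish: a triple valid only on a Zariski
  neighbourhood can be multiplied by a form vanishing on the complement but not at the point.
\<close>

definition regular_on :: "cp2 set \<Rightarrow> (cp2 \<Rightarrow> cp2) \<Rightarrow> bool" where
  "regular_on V f \<longleftrightarrow>
     (\<forall>p\<in>V. \<exists>k P. (\<forall>i. homogeneous k (P i)) \<and> peval_tuple P (rep_cp2 p) \<noteq> 0 \<and>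
        (\<forall>q\<in>V. peval_tuple P (rep_cp2 q) \<noteq> 0 \<longrightarrow>
           f q = abs_cp2 (peval_tuple P (rep_cp2 q))))"

definition isomorphism :: "cp2 set \<Rightarrow> cp2 set \<Rightarrow> (cp2 \<Rightarrow> cp2) \<Rightarrow> bool" where
  "isomorphism V W f \<longleftrightarrow>
     bij_betw f V W \<and> regular_on V f \<and> regular_on W (inv_into V f)"

section \<open>Cocycles and real forms of the Fermat curve\<close>

definition fermat :: "nat \<Rightarrow> cp2 set" where
  "fermat d = zero_locus (Y0 ^ d + Y1 ^ d + Y2 ^ d)"

text \<open>The real structure \<open>\<rho>\<close> is the restriction of \<^const>\<open>conj_cp2\<close> to \<^term>\<open>fermat d\<close>.\<close>

definition cocycle :: "nat \<Rightarrow> (cp2 \<Rightarrow> cp2) \<Rightarrow> bool" where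
  "cocycle d \<alpha> \<longleftrightarrow>
     isomorphism (fermat d) (fermat d) \<alpha> \<and>
     (\<forall>p\<in>fermat d. ((\<alpha> \<circ> conj_cp2) ^^ 2) p = p)"

text \<open>
  A real plane curve \<open>(G = 0)\<close> in the real projective plane is represented by its equation \<open>G\<close>,
  a form with real coefficients.  Its complexification is the complex zero locus of \<open>G\<close> equipped
  with complex conjugation; note that the real points alone do not determine the real variety.
  Squarefreeness of \<open>G\<close> over the complex numbers says that the complexification is reduced, so
  that it is the classical variety given by its zero locus.
\<close>

definition real_plane_curve :: "cpoly3 \<Rightarrow> bool" where
  "real_plane_curve G \<longleftrightarrow> real_coeffs G \<and> (\<exists>k. homogeneous k G) \<and> squarefree G"

text \<open>
  The curve \<open>(G = 0)\<close> is the real form of the Fermat curve corresponding to \<open>\<alpha>\<close>: some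
  isomorphism from its complexification to the Fermat curve carries complex conjugation to the
  real structure \<open>\<alpha> \<circ> \<rho>\<close>.
\<close>

definition corresponding_real_form :: "nat \<Rightarrow> (cp2 \<Rightarrow> cp2) \<Rightarrow> cpoly3 \<Rightarrow> bool" where
  "corresponding_real_form d \<alpha> G \<longleftrightarrow>
     cocycle d \<alpha> \<and> real_plane_curve G \<and>
     (\<exists>\<phi>. isomorphism (zero_locus G) (fermat d) \<phi> \<and>
          (\<forall>p\<in>zero_locus G. \<phi> (conj_cp2 p) = (\<alpha> \<circ> conj_cp2) (\<phi> p)))"

definition primitive_root_of_unity :: "nat \<Rightarrow> complex \<Rightarrow> bool" where
  "primitive_root_of_unity d \<xi> \<longleftrightarrow> \<xi> ^ d = 1 \<and> (\<forall>k. 0 < k \<and> k < d \<longrightarrow> \<xi> ^ k \<noteq> 1)"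

definition K03 :: "complex^3^3" where
  "K03 = mat 1"

definition K12 :: "complex \<Rightarrow> complex^3^3" where
  "K12 \<xi> = vector [vector [\<xi>, 0, 0], vector [0, 1, 0], vector [0, 0, 1]]"

definition K01 :: "complex^3^3" where
  "K01 = vector [vector [1, 0, 0], vector [0, 0, 1], vector [0, 1, 0]]"

end

theory Submission
  imports Defs
begin

text \<open>
  For an invertible matrix \<open>M\<close> with \<open>M = A \<sigma>(M)\<close>, where \<open>\<sigma>\<close> is complex conjugation of
  the entries, the linear map \<open>M\<close> carries complex conjugation to the real structure \<open>A \<circ> \<rho>\<close>.
  Hence the pullback under \<open>M\<close> of the Fermat equation defines the real form of \<open>A\<close>.  Suitable
  matrices are the identity, \<open>diag(\<eta>, 1, 1)\<close> with \<open>\<eta>\<^sup>2 = \<xi>\<close> and \<open>\<eta>\<^sup>d = -1\<close>, and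
  the change of variables \<open>(Y\<^sub>0, Y\<^sub>1 + \<i> Y\<^sub>2, Y\<^sub>1 - \<i> Y\<^sub>2)\<close>.

  All three equations have the form \<open>G = a Y\<^sub>0\<^sup>d + R(Y\<^sub>1, Y\<^sub>2)\<close>.  If \<open>x\<^sup>2\<close> divides
  \<open>G\<close>, the derivation \<open>Y\<^sub>0 \<partial>/\<partial>Y\<^sub>0\<close> shows that \<open>x\<close> divides \<open>Y\<^sub>0\<^sup>d\<close>, so
  \<open>x\<close> is a multiple of a power of \<open>Y\<^sub>0\<close>.  This power is trivial, since \<open>Y\<^sub>0\<close> does not divide
  \<open>R\<close>.
\<close>

section \<open>Polynomial mappings\<close>

text \<open>Updating a fresh key amounts to adding one monomial. Two nested uses reduce a biadditive
  identity, such as multiplicativity of evaluation or the Leibniz rule, to a pair of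
  monomials.\<close>

lemma poly_mapping_add_induct [case_names zero single add]:
  fixes p :: "'a \<Rightarrow>\<^sub>0 'b::comm_monoid_add"
  assumes zero: "P 0"
    and single: "\<And>m c. P (Poly_Mapping.single m c)"
    and add: "\<And>p q. P p \<Longrightarrow> P q \<Longrightarrow> P (p + q)"
  shows "P p"
proof (induction p rule: update_induct)
  case const
  show ?case by (rule zero)
next
  case (update f a b)
  have "Poly_Mapping.update a b f = f + Poly_Mapping.single a b"
    using update(1) by (intro poly_mapping_eqI)
      (auto simp: lookup_update lookup_add lookup_single when_def in_keys_iff)
  then show ?case
    using update single add by metis
qed

text \<open>Only one pair of exponents can contribute to the coefficient at \<open>k + l\<close>.
  Splitting off the terms \<open>s\<close> and \<open>t\<close> at \<open>k\<close> and
  \<open>l\<close> isolates this contribution as \<open>s * t\<close>.\<close>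

lemma lookup_mult_unique:
  fixes f g :: "'a::{cancel_ab_semigroup_add, comm_monoid_add} \<Rightarrow>\<^sub>0 'b::comm_ring_1"
  assumes unique: "\<And>a b. a \<in> Poly_Mapping.keys f \<Longrightarrow> b \<in> Poly_Mapping.keys g \<Longrightarrow>
      a + b = k + l \<Longrightarrow> a = k \<and> b = l"
  shows "Poly_Mapping.lookup (f * g) (k + l) =
    Poly_Mapping.lookup f k * Poly_Mapping.lookup g l"
proof -
  define s where "s = Poly_Mapping.single k (Poly_Mapping.lookup f k)"
  define t where "t = Poly_Mapping.single l (Poly_Mapping.lookup g l)"
  define f' where "f' = f - s"
  define g' where "g' = g - t"
  have f': "a \<in> Poly_Mapping.keys f \<and> a \<noteq> k" if "a \<in> Poly_Mapping.keys f'" for a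
    using that by (auto simp: f'_def s_def in_keys_iff lookup_minus lookup_single when_def
      split: if_splits)
  have g': "b \<in> Poly_Mapping.keys g \<and> b \<noteq> l" if "b \<in> Poly_Mapping.keys g'" for b
    using that by (auto simp: g'_def t_def in_keys_iff lookup_minus lookup_single when_def
      split: if_splits)
  have s: "a = k" if "a \<in> Poly_Mapping.keys s" for a
    using that by (auto simp: s_def split: if_splits)
  have "f * g = s * t + s * g' + f' * g"
    by (simp add: f'_def g'_def algebra_simps)
  \<comment> \<open>The only exponent of \<open>s\<close> is \<open>k\<close>, so cancellation would
    force the exponent \<open>l\<close>, which \<open>g'\<close> lacks.\<close>
  moreover have "k + l \<notin> Poly_Mapping.keys (s * g')"
    using keys_mult[of s g'] by (auto dest!: s g')
  moreover have "k + l \<notin> Poly_Mapping.keys (f' * g)"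
  proof
    assume "k + l \<in> Poly_Mapping.keys (f' * g)"
    then obtain a b where "a \<in> Poly_Mapping.keys f'" "b \<in> Poly_Mapping.keys g" "a + b = k + l"
      using keys_mult[of f' g] by auto
    then show False
      using f' unique by blast
  qed
  ultimately show ?thesis
    by (simp add: lookup_add in_keys_iff s_def t_def mult_single)
qed

text \<open>
  For a linear order compatible with addition, the sums of the largest and of the smallest
  exponents of the two factors are exponents of the product.
\<close>
lemma monomial_factor:
  fixes f g :: "'a::{ordered_cancel_comm_monoid_add, linorder} \<Rightarrow>\<^sub>0 'b::idom"
  assumes prod: "f * g = Poly_Mapping.single m c" and "c \<noteq> 0"
  obtains k a l b where "f = Poly_Mapping.single k a" "g = Poly_Mapping.single l b" "k + l = m"
proof -
  let ?F = "Poly_Mapping.keys f" and ?G = "Poly_Mapping.keys g"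
  have "f * g \<noteq> 0"
    using assms by (metis lookup_single_eq lookup_zero)
  then have "f \<noteq> 0" "g \<noteq> 0"
    by auto
  then have ne: "?F \<noteq> {}" "?G \<noteq> {}"
    by simp_all
  have eq_m: "k + l = m"
    if "k \<in> ?F" "l \<in> ?G"
      "\<And>a b. a \<in> ?F \<Longrightarrow> b \<in> ?G \<Longrightarrow> a + b = k + l \<Longrightarrow> a = k \<and> b = l" for k l
  proof -
    have "Poly_Mapping.lookup (f * g) (k + l) =
        Poly_Mapping.lookup f k * Poly_Mapping.lookup g l"
      by (rule lookup_mult_unique) (rule that(3))
    then have "Poly_Mapping.lookup (f * g) (k + l) \<noteq> 0"
      using that(1,2) by (simp add: in_keys_iff)
    then show ?thesis
      by (auto simp: prod lookup_single when_def split: if_splits)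
  qed
  \<comment> \<open>A strict inequality in either summand would make the sum strict as well.\<close>
  have split: "a = k \<and> b = l"
    if "a \<le> k" "b \<le> l" "a + b = k + l" for a b k l :: 'a
    using that add_less_le_mono[of a k b l] add_le_less_mono[of a k b l]
    by (metis order_less_irrefl order_le_less)
  have max: "Max ?F + Max ?G = m"
  proof (rule eq_m)
    fix a b assume "a \<in> ?F" "b \<in> ?G" "a + b = Max ?F + Max ?G"
    then show "a = Max ?F \<and> b = Max ?G"
      by (intro split) simp_all
  qed (simp_all add: \<open>f \<noteq> 0\<close> \<open>g \<noteq> 0\<close>)
  have min: "Min ?F + Min ?G = m"
  proof (rule eq_m)
    fix a b assume "a \<in> ?F" "b \<in> ?G" "a + b = Min ?F + Min ?G"
    then have "Min ?F = a \<and> Min ?G = b"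
      by (intro split) simp_all
    then show "a = Min ?F \<and> b = Min ?G"
      by simp
  qed (simp_all add: \<open>f \<noteq> 0\<close> \<open>g \<noteq> 0\<close>)
  \<comment> \<open>The extreme sums agree although each minimum is at most its maximum, so each
    factor has a single exponent.\<close>
  have "Min ?F = Max ?F \<and> Min ?G = Max ?G"
    using ne max min by (intro split) auto
  then have F: "a = Max ?F" if "a \<in> ?F" for a
    using that by (metis Max_ge Min_le antisym finite_keys)
  have G: "b = Max ?G" if "b \<in> ?G" for b
    using that \<open>Min ?F = Max ?F \<and> Min ?G = Max ?G\<close>
    by (metis Max_ge Min_le antisym finite_keys)
  have "f = Poly_Mapping.single (Max ?F) (Poly_Mapping.lookup f (Max ?F))"
    using F by (intro poly_mapping_eqI) (auto simp: lookup_single when_def in_keys_iff)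
  moreover have "g = Poly_Mapping.single (Max ?G) (Poly_Mapping.lookup g (Max ?G))"
    using G by (intro poly_mapping_eqI) (auto simp: lookup_single when_def in_keys_iff)
  ultimately show ?thesis
    using max that by blast
qed

section \<open>Evaluation, homogeneity and real coefficients\<close>

lemma peval_single:
  "peval (Poly_Mapping.single m c) v = c * (\<Prod>i\<in>UNIV. (v $ i) ^ Poly_Mapping.lookup m i)"
  by (simp add: peval_def)

lemma peval_zero [simp]: "peval 0 v = 0"
  by (simp add: peval_def)

lemma peval_add [simp]: "peval (p + q) v = peval p v + peval q v"
  unfolding peval_def by (rule setsum_keys_plus_distrib) (simp_all add: algebra_simps)

lemma peval_uminus [simp]: "peval (- p) v = - peval p v"
  using peval_add[of p "- p" v] by (simp add: eq_neg_iff_add_eq_0 add.commute)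

lemma peval_diff [simp]: "peval (p - q) v = peval p v - peval q v"
  using peval_add[of p "- q" v] by simp

lemma peval_mult [simp]: "peval (p * q) v = peval p v * peval q v"
proof (induction p rule: poly_mapping_add_induct)
  case (single m c)
  show ?case
    by (induction q rule: poly_mapping_add_induct)
      (simp_all add: mult_single peval_single lookup_add power_add prod.distrib algebra_simps)
qed (simp_all add: algebra_simps)

lemma peval_pconst [simp]: "peval (pconst c) v = c"
  by (simp add: pconst_def peval_single)

lemma pconst_1: "pconst 1 = 1"
  by (simp add: pconst_def)

lemma peval_one [simp]: "peval 1 v = 1"
  using peval_pconst[of 1 v] by (simp only: pconst_1)

lemma peval_power [simp]: "peval (p ^ n) v = peval p v ^ n"
  by (induction n) simp_all

lemma peval_pvar [simp]: "peval (pvar i) v = v $ i"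
proof -
  have "(\<Prod>j\<in>UNIV. (v $ j) ^ Poly_Mapping.lookup (Poly_Mapping.single i 1) j) =
      (\<Prod>j\<in>UNIV. if j = i then v $ j else 1)"
    by (rule prod.cong) (auto simp: lookup_single)
  then show ?thesis
    by (simp add: pvar_def peval_single)
qed

lemma peval_sum [simp]: "peval (sum f I) v = (\<Sum>i\<in>I. peval (f i) v)"
  by (induction I rule: infinite_finite_induct) simp_all

section \<open>Closure properties of homogeneous polynomials\<close>

lemma homogeneous_pvar: "homogeneous 1 (pvar i)"
  by (simp add: homogeneous_def pvar_def lookup_single when_def)

lemma homogeneous_pconst: "homogeneous 0 (pconst c)"
  by (simp add: homogeneous_def pconst_def)

lemma homogeneous_add: "homogeneous k p \<Longrightarrow> homogeneous k q \<Longrightarrow> homogeneous k (p + q)"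
  using keys_add[of p q] by (fastforce simp: homogeneous_def)

lemma homogeneous_uminus: "homogeneous k p \<Longrightarrow> homogeneous k (- p)"
  by (simp add: homogeneous_def in_keys_iff)

lemma homogeneous_diff: "homogeneous k p \<Longrightarrow> homogeneous k q \<Longrightarrow> homogeneous k (p - q)"
  using homogeneous_add[OF _ homogeneous_uminus] by (metis diff_conv_add_uminus)

lemma homogeneous_mult: "homogeneous k p \<Longrightarrow> homogeneous l q \<Longrightarrow> homogeneous (k + l) (p * q)"
  using keys_mult[of p q] by (fastforce simp: homogeneous_def lookup_add sum.distrib)

lemma homogeneous_pconst_mult: "homogeneous k p \<Longrightarrow> homogeneous k (pconst c * p)"
  using homogeneous_mult[OF homogeneous_pconst] by simp

lemma homogeneous_power: "homogeneous 1 p \<Longrightarrow> homogeneous n (p ^ n)"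
proof (induction n)
  case 0
  show ?case
    using homogeneous_pconst[of 1] by (simp add: pconst_1)
next
  case (Suc n)
  then show ?case
    using homogeneous_mult[of 1 p n "p ^ n"] by simp
qed

lemma homogeneous_sum: "(\<And>i. i \<in> I \<Longrightarrow> homogeneous k (f i)) \<Longrightarrow> homogeneous k (sum f I)"
  by (induction I rule: infinite_finite_induct) (auto simp: homogeneous_add homogeneous_def[of _ 0])

lemmas homogeneous_intros = homogeneous_add homogeneous_diff homogeneous_uminus
  homogeneous_power homogeneous_pvar homogeneous_pconst_mult

lemma peval_homogeneous_smult:
  assumes "homogeneous k p"
  shows "peval p (c *s v) = c ^ k * peval p v"
  unfolding peval_def sum_distrib_left
proof (rule sum.cong)
  fix m assume "m \<in> Poly_Mapping.keys p"
  then have "(\<Sum>i\<in>UNIV. Poly_Mapping.lookup m i) = k"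
    using assms by (simp add: homogeneous_def)
  then show "Poly_Mapping.lookup p m * (\<Prod>i\<in>UNIV. ((c *s v) $ i) ^ Poly_Mapping.lookup m i) =
      c ^ k * (Poly_Mapping.lookup p m * (\<Prod>i\<in>UNIV. (v $ i) ^ Poly_Mapping.lookup m i))"
    by (simp add: power_mult_distrib prod.distrib flip: power_sum)
qed simp

section \<open>Closure properties of real coefficients\<close>

lemma real_coeffs_pvar: "real_coeffs (pvar i)"
  by (simp add: real_coeffs_def pvar_def lookup_single when_def)

lemma real_coeffs_pconst: "c \<in> \<real> \<Longrightarrow> real_coeffs (pconst c)"
  by (simp add: real_coeffs_def pconst_def lookup_single when_def)

lemma real_coeffs_add: "real_coeffs p \<Longrightarrow> real_coeffs q \<Longrightarrow> real_coeffs (p + q)"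
  by (simp add: real_coeffs_def lookup_add)

lemma real_coeffs_uminus: "real_coeffs p \<Longrightarrow> real_coeffs (- p)"
  by (simp add: real_coeffs_def)

lemma real_coeffs_diff: "real_coeffs p \<Longrightarrow> real_coeffs q \<Longrightarrow> real_coeffs (p - q)"
  by (simp add: real_coeffs_def lookup_minus)

lemma real_coeffs_mult: "real_coeffs p \<Longrightarrow> real_coeffs q \<Longrightarrow> real_coeffs (p * q)"
  unfolding real_coeffs_def lookup_mult Sum_any.expand_set
  by (auto simp: when_def intro!: sum_in_Reals Reals_mult)

lemma real_coeffs_power: "real_coeffs p \<Longrightarrow> real_coeffs (p ^ n)"
proof (induction n)
  case 0
  show ?case
    using real_coeffs_pconst[of 1] by (simp add: pconst_1)
qed (simp add: real_coeffs_mult)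

lemmas real_coeffs_intros = real_coeffs_add real_coeffs_diff real_coeffs_uminus
  real_coeffs_mult real_coeffs_power real_coeffs_pvar real_coeffs_pconst

text \<open>Power sums of two elements satisfy a two-term recurrence whose coefficients are their
  sum and product. This serves for conjugate factors that are not real individually.\<close>

lemma real_coeffs_power_sum:
  assumes "real_coeffs (p + q)" "real_coeffs (p * q)"
  shows "real_coeffs (p ^ n + q ^ n)"
proof (induction n rule: less_induct)
  case (less n)
  consider "n = 0" | "n = 1" | m where "n = Suc (Suc m)"
    by (metis One_nat_def not0_implies_Suc)
  then show ?case
  proof cases
    case 1
    then show ?thesis
      using real_coeffs_pconst[of 1] real_coeffs_add[of 1 1] by (simp add: pconst_1)
  next
    case 2
    then show ?thesis using assms by simp
  next
    case 3
    have "p ^ n + q ^ n = (p + q) * (p ^ Suc m + q ^ Suc m) - p * q * (p ^ m + q ^ m)"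
      by (simp add: 3 algebra_simps)
    then show ?thesis
      using less[of "Suc m"] less[of m] assms 3 by (simp add: real_coeffs_diff real_coeffs_mult)
  qed
qed

section \<open>Squarefreeness\<close>

text \<open>The derivation \<open>Y\<^sub>i \<partial>/\<partial>Y\<^sub>i\<close>.\<close>
definition euler_deriv :: "3 \<Rightarrow> cpoly3 \<Rightarrow> cpoly3" where
  "euler_deriv i = Poly_Mapping.mapp (\<lambda>m c. of_nat (Poly_Mapping.lookup m i) * c)"

lemma lookup_euler_deriv:
  "Poly_Mapping.lookup (euler_deriv i p) m =
    of_nat (Poly_Mapping.lookup m i) * Poly_Mapping.lookup p m"
  by (simp add: euler_deriv_def lookup_mapp when_def in_keys_iff)

lemma euler_deriv_zero: "euler_deriv i 0 = 0"
  by (rule poly_mapping_eqI) (simp add: lookup_euler_deriv)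

lemma euler_deriv_add: "euler_deriv i (p + q) = euler_deriv i p + euler_deriv i q"
  by (rule poly_mapping_eqI) (simp add: lookup_euler_deriv lookup_add algebra_simps)

lemma euler_deriv_diff: "euler_deriv i (p - q) = euler_deriv i p - euler_deriv i q"
  by (rule poly_mapping_eqI) (simp add: lookup_euler_deriv lookup_minus algebra_simps)

lemma euler_deriv_single:
  "euler_deriv i (Poly_Mapping.single m c) =
    Poly_Mapping.single m (of_nat (Poly_Mapping.lookup m i) * c)"
  by (rule poly_mapping_eqI) (simp add: lookup_euler_deriv lookup_single when_def)

text \<open>Leibniz rule: on monomials it says that the exponents of the chosen variable add up in a
  product.\<close>

lemma euler_deriv_mult: "euler_deriv i (p * q) = euler_deriv i p * q + p * euler_deriv i q"
proof (induction p rule: poly_mapping_add_induct)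
  case (single m c)
  show ?case
    by (induction q rule: poly_mapping_add_induct)
      (simp_all add: euler_deriv_zero euler_deriv_add euler_deriv_single mult_single lookup_add
        algebra_simps single_add)
qed (simp_all add: euler_deriv_zero euler_deriv_add algebra_simps)

lemma euler_deriv_pconst: "euler_deriv i (pconst c) = 0"
  by (simp add: pconst_def euler_deriv_single)

lemma euler_deriv_pvar_other: "i \<noteq> j \<Longrightarrow> euler_deriv i (pvar j) = 0"
  by (simp add: pvar_def euler_deriv_single lookup_single)

lemma euler_deriv_power_eq_0: "euler_deriv i p = 0 \<Longrightarrow> euler_deriv i (p ^ n) = 0"
  by (induction n) (simp_all add: euler_deriv_mult euler_deriv_pconst flip: pconst_1)

lemma pvar_power: "pvar i ^ n = Poly_Mapping.single (Poly_Mapping.single i n) 1"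
  by (induction n) (simp_all add: pvar_def mult_single flip: single_add)

text \<open>The point \<open>v\<close> on the line \<open>pvar i = 0\<close> with \<open>R\<close>
  nonzero there witnesses that \<open>pvar i\<close> does not divide \<open>R\<close>.\<close>

lemma squarefree_pvar_power_add:
  assumes d: "d > 0" and a: "a \<noteq> 0"
    and R: "euler_deriv i R = 0" "peval R v \<noteq> 0" and v: "v $ i = 0"
  shows "squarefree (pconst a * pvar i ^ d + R)" (is "squarefree ?G")
proof (rule squarefreeI)
  fix x assume "x ^ 2 dvd ?G"
  then obtain h where h: "?G = x ^ 2 * h"
    by (elim dvdE)
  have "peval ?G v \<noteq> 0"
    using d R(2) v by (simp add: zero_power)
  then have xv: "peval x v \<noteq> 0"
    by (simp add: h)
  have "euler_deriv i ?G = Poly_Mapping.single (Poly_Mapping.single i d) (of_nat d * a)"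
    by (simp add: euler_deriv_add R(1) pvar_power pconst_def mult_single euler_deriv_single)
  moreover have "euler_deriv i ?G = x * (2 * euler_deriv i x * h + x * euler_deriv i h)"
    unfolding h by (simp add: power2_eq_square euler_deriv_mult algebra_simps)
  ultimately have "x * (2 * euler_deriv i x * h + x * euler_deriv i h) =
      Poly_Mapping.single (Poly_Mapping.single i d) (of_nat d * a)"
    by simp
  \<comment> \<open>Exponent vectors carry a linear order compatible with addition, and
    \<open>of_nat d * a\<close> is nonzero, so the factor \<open>x\<close> is a monomial.\<close>
  then obtain k c l b where x: "x = Poly_Mapping.single k c" and kl: "k + l = Poly_Mapping.single i d"
    by (rule monomial_factor) (use a d in auto)
  \<comment> \<open>For \<open>j = i\<close>, a positive exponent would make \<open>x\<close> vanish
    at \<open>v\<close>. For other \<open>j\<close>, the exponents in \<open>k\<close> and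
    \<open>l\<close> are naturals with sum zero.\<close>
  have "Poly_Mapping.lookup k j = 0" for j
  proof (cases "j = i")
    case True
    show ?thesis
    proof (rule ccontr)
      assume "Poly_Mapping.lookup k j \<noteq> 0"
      then have "(\<Prod>i\<in>UNIV. (v $ i) ^ Poly_Mapping.lookup k i) = 0"
        using v True by (intro prod_zero) (auto intro!: bexI[of _ i])
      then show False
        using xv by (simp add: x peval_single)
    qed
  next
    case False
    then show ?thesis
      using arg_cong[OF kl, of "\<lambda>m. Poly_Mapping.lookup m j"]
      by (simp add: lookup_add lookup_single)
  qed
  then have "k = 0"
    by (intro poly_mapping_eqI) simp
  have "c \<noteq> 0"
    using xv by (auto simp: x peval_single)
  then have "x * pconst (1 / c) = 1"
    by (simp add: x \<open>k = 0\<close> pconst_def mult_single)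
  then show "x dvd 1"
    by (metis dvd_triv_left)
qed

section \<open>Linear maps of the projective plane\<close>

lemma rep_cp2_nonzero: "rep_cp2 p \<noteq> 0"
  using Quotient3_rep_reflp[OF Quotient3_cp2, of p] by (simp add: proj_rel_def)

lemma abs_rep_cp2: "abs_cp2 (rep_cp2 p) = p"
  by (rule Quotient3_abs_rep[OF Quotient3_cp2])

lemma proj_rel_refl: "v \<noteq> 0 \<Longrightarrow> proj_rel v v"
  by (auto simp: proj_rel_def intro!: exI[of _ 1])

lemma rep_abs_cp2:
  assumes "v \<noteq> 0"
  obtains c where "c \<noteq> 0" "rep_cp2 (abs_cp2 v) = c *s v"
  using rep_abs_rsp[OF Quotient3_cp2 proj_rel_refl[OF assms]] by (auto simp: proj_rel_def)

lemma abs_cp2_smult: "c \<noteq> 0 \<Longrightarrow> v \<noteq> 0 \<Longrightarrow> abs_cp2 (c *s v) = abs_cp2 v"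
  by (rule Quotient3_rel_abs[OF Quotient3_cp2])
    (auto simp: proj_rel_def intro!: exI[of _ "inverse c"])

text \<open>The chosen representative is an unknown nonzero multiple of \<open>v\<close>;
  homogeneity turns it into a nonzero factor \<open>c ^ k\<close>.\<close>

lemma mem_zero_locus_abs_cp2:
  assumes "homogeneous k G" "v \<noteq> 0"
  shows "abs_cp2 v \<in> zero_locus G \<longleftrightarrow> peval G v = 0"
proof -
  obtain c where "c \<noteq> 0" "rep_cp2 (abs_cp2 v) = c *s v"
    using assms(2) by (rule rep_abs_cp2)
  then show ?thesis
    by (simp add: zero_locus_def peval_homogeneous_smult[OF assms(1)])
qed

lemma matrix_vector_mult_nonzero:
  fixes A B :: "complex^3^3"
  assumes "B ** A = mat 1" "v \<noteq> 0"
  shows "A *v v \<noteq> 0"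
proof
  assume "A *v v = 0"
  then have "(B ** A) *v v = 0"
    by (simp flip: matrix_vector_mul_assoc)
  then show False
    using assms by simp
qed

text \<open>Independence of the representative: \<open>A\<close> commutes with scalars, and the left
  inverse keeps \<open>A *v v\<close> nonzero.\<close>

lemma linear_cp2_abs:
  assumes "B ** A = mat 1" "v \<noteq> 0"
  shows "linear_cp2 A (abs_cp2 v) = abs_cp2 (A *v v)"
proof -
  obtain c where c: "c \<noteq> 0" "rep_cp2 (abs_cp2 v) = c *s v"
    using assms(2) by (rule rep_abs_cp2)
  then show ?thesis
    using matrix_vector_mult_nonzero[OF assms]
    by (simp add: linear_cp2_def vector_scalar_commute abs_cp2_smult)
qed

lemma linear_cp2_mult:
  assumes "B ** A = mat 1" "B' ** A' = mat 1"
  shows "linear_cp2 A (linear_cp2 A' p) = linear_cp2 (A ** A') p"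
  unfolding linear_cp2_def[of A'] linear_cp2_def[of "A ** A'"]
  by (simp add: linear_cp2_abs[OF assms(1)] matrix_vector_mult_nonzero[OF assms(2)]
    rep_cp2_nonzero matrix_vector_mul_assoc)

lemma linear_cp2_mat_1: "linear_cp2 (mat 1) p = p"
  by (simp add: linear_cp2_def abs_rep_cp2)

section \<open>Complex conjugation of matrices and points\<close>

definition cnj_matrix :: "complex^3^3 \<Rightarrow> complex^3^3" where
  "cnj_matrix A = (\<chi> i j. cnj (A $ i $ j))"

lemma cnj_matrix_mult: "cnj_matrix (A ** B) = cnj_matrix A ** cnj_matrix B"
  by (simp add: cnj_matrix_def matrix_matrix_mult_def)

lemma cnj_matrix_mat_1: "cnj_matrix (mat 1) = mat 1"
  by (simp add: cnj_matrix_def mat_def vec_eq_iff)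

text \<open>Conjugation is semilinear, so it passes a matrix at the price of conjugating the
  entries. This turns conditions on real structures into matrix identities.\<close>

lemma conj_cp2_linear_cp2:
  assumes "B ** A = mat 1"
  shows "conj_cp2 (linear_cp2 A p) = linear_cp2 (cnj_matrix A) (conj_cp2 p)"
proof -
  let ?v = "rep_cp2 p"
  define w where "w = (\<chi> i. cnj (?v $ i))"
  have "w \<noteq> 0"
    using rep_cp2_nonzero[of p] by (auto simp: w_def vec_eq_iff)
  have "conj_cp2 (linear_cp2 A p) = abs_cp2 (\<chi> i. cnj ((A *v ?v) $ i))"
    unfolding linear_cp2_def
    by (rule conj_cp2.abs_eq) (simp add: proj_rel_refl matrix_vector_mult_nonzero[OF assms] rep_cp2_nonzero)
  also have "(\<chi> i. cnj ((A *v ?v) $ i)) = cnj_matrix A *v w"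
    by (simp add: cnj_matrix_def w_def matrix_vector_mult_def)
  also have "abs_cp2 (cnj_matrix A *v w) = linear_cp2 (cnj_matrix A) (abs_cp2 w)"
    using assms \<open>w \<noteq> 0\<close>
    by (intro linear_cp2_abs[symmetric, of "cnj_matrix B"])
      (simp_all add: cnj_matrix_mat_1 flip: cnj_matrix_mult)
  also have "abs_cp2 w = conj_cp2 p"
    using conj_cp2.abs_eq[OF proj_rel_refl[OF rep_cp2_nonzero[of p]]]
    by (simp add: abs_rep_cp2 w_def)
  finally show ?thesis .
qed

lemma conj_cp2_conj_cp2: "conj_cp2 (conj_cp2 p) = p"
proof -
  define v where "v = rep_cp2 p"
  have v: "v \<noteq> 0" "p = abs_cp2 v"
    by (simp_all add: v_def rep_cp2_nonzero abs_rep_cp2)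
  then have "(\<chi> i. cnj (v $ i)) \<noteq> 0"
    by (auto simp: vec_eq_iff)
  then show ?thesis
    using v by (simp add: conj_cp2.abs_eq proj_rel_refl)
qed

section \<open>Linear isomorphisms between plane curves\<close>

lemma regular_on_linear_cp2:
  assumes "B ** A = mat 1"
  shows "regular_on V (linear_cp2 A)"
proof -
  \<comment> \<open>The rows of \<open>A\<close>, read as linear forms, give one triple valid at
    every point.\<close>
  define P where "P i = (\<Sum>j\<in>UNIV. pconst (A $ i $ j) * pvar j)" for i
  have "homogeneous 1 (P i)" for i
    by (auto simp: P_def simp del: One_nat_def
      intro!: homogeneous_sum homogeneous_pconst_mult homogeneous_pvar)
  moreover have "peval_tuple P v = A *v v" for v
    by (simp add: peval_tuple_def P_def matrix_vector_mult_def)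
  ultimately show ?thesis
    unfolding regular_on_def using matrix_vector_mult_nonzero[OF assms] rep_cp2_nonzero
    by (intro ballI exI[of _ 1] exI[of _ P]) (simp add: linear_cp2_def)
qed

lemma regular_on_cong:
  assumes "\<And>p. p \<in> V \<Longrightarrow> f p = g p"
  shows "regular_on V f \<longleftrightarrow> regular_on V g"
  using assms unfolding regular_on_def by simp

text \<open>The substitution identity \<open>eval\<close> inverts: \<open>B\<close> pulls
  \<open>G\<close> back to \<open>F\<close>. Hence both matrices preserve the zero loci and induce
  mutually inverse regular maps.\<close>

lemma isomorphism_linear_cp2:
  assumes hom: "homogeneous k F" "homogeneous l G"
    and BA: "B ** A = mat 1"
    and eval: "\<And>v. peval F (A *v v) = peval G v"
  shows "isomorphism (zero_locus G) (zero_locus F) (linear_cp2 A)"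
proof -
  have AB: "A ** B = mat 1"
    using BA by (simp add: matrix_left_right_inverse)
  have eval': "peval G (B *v v) = peval F v" for v
    using eval[of "B *v v"] by (simp add: matrix_vector_mul_assoc AB)
  have inv: "linear_cp2 B (linear_cp2 A p) = p" "linear_cp2 A (linear_cp2 B p) = p" for p
    by (simp_all add: linear_cp2_mult[OF AB BA] linear_cp2_mult[OF BA AB] AB BA linear_cp2_mat_1)
  have maps: "linear_cp2 A p \<in> zero_locus F" if "p \<in> zero_locus G" for p
    using that by (simp add: linear_cp2_def mem_zero_locus_abs_cp2[OF hom(1)] rep_cp2_nonzero
      matrix_vector_mult_nonzero[OF BA] eval) (simp add: zero_locus_def)
  have maps': "linear_cp2 B p \<in> zero_locus G" if "p \<in> zero_locus F" for p
    using that by (simp add: linear_cp2_def mem_zero_locus_abs_cp2[OF hom(2)] rep_cp2_nonzero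
      matrix_vector_mult_nonzero[OF AB] eval') (simp add: zero_locus_def)
  have bij: "bij_betw (linear_cp2 A) (zero_locus G) (zero_locus F)"
    by (rule bij_betw_byWitness[of _ "linear_cp2 B"]) (auto simp: inv maps maps')
  \<comment> \<open>\<open>inv_into\<close> is only controlled on the image, which is all that
    regularity on \<open>zero_locus F\<close> sees.\<close>
  have "inv_into (zero_locus G) (linear_cp2 A) q = linear_cp2 B q" if "q \<in> zero_locus F" for q
    using that bij maps' inv by (intro inv_into_f_eq) (auto simp: bij_betw_def)
  then have "regular_on (zero_locus F) (inv_into (zero_locus G) (linear_cp2 A))"
    using regular_on_cong regular_on_linear_cp2[OF AB] by blast
  then show ?thesis
    using bij regular_on_linear_cp2[OF BA] by (simp add: isomorphism_def)
qed

section \<open>Real forms of the Fermat curve\<close>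

lemma homogeneous_fermat: "homogeneous d (Y0 ^ d + Y1 ^ d + Y2 ^ d)"
  by (intro homogeneous_intros)

text \<open>Moving conjugation to the right, the square of the real structure becomes
  \<open>A ** cnj_matrix A\<close>, and equivariance of \<open>M\<close> becomes
  \<open>M = A ** cnj_matrix M\<close>. The hypothesis \<open>M_eval\<close> makes \<open>G\<close>
  the pullback of the Fermat equation.\<close>

lemma corresponding_real_form_linear:
  assumes A: "A ** cnj_matrix A = mat 1"
    and A_fermat: "\<And>v. peval (Y0 ^ d + Y1 ^ d + Y2 ^ d) (A *v v) = peval (Y0 ^ d + Y1 ^ d + Y2 ^ d) v"
    and M: "N ** M = mat 1" "M = A ** cnj_matrix M"
    and M_eval: "\<And>v. peval (Y0 ^ d + Y1 ^ d + Y2 ^ d) (M *v v) = peval G v"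
    and G: "homogeneous d G" "real_coeffs G" "squarefree G"
  shows "corresponding_real_form d (linear_cp2 A) G"
proof -
  have A': "cnj_matrix A ** A = mat 1"
    using A by (simp add: matrix_left_right_inverse)
  have M': "cnj_matrix N ** cnj_matrix M = mat 1"
    using M(1) by (simp add: cnj_matrix_mat_1 flip: cnj_matrix_mult)
  have "isomorphism (fermat d) (fermat d) (linear_cp2 A)"
    unfolding fermat_def
    using homogeneous_fermat homogeneous_fermat A' A_fermat by (rule isomorphism_linear_cp2)
  moreover have "((linear_cp2 A \<circ> conj_cp2) ^^ 2) p = p" for p
    by (simp add: numeral_2_eq_2 conj_cp2_linear_cp2[OF A'] conj_cp2_conj_cp2
      linear_cp2_mult[OF A' A] A linear_cp2_mat_1)
  ultimately have "cocycle d (linear_cp2 A)"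
    by (simp add: cocycle_def)
  moreover have "real_plane_curve G"
    using G by (auto simp: real_plane_curve_def)
  moreover have "isomorphism (zero_locus G) (fermat d) (linear_cp2 M)"
    unfolding fermat_def
    using homogeneous_fermat G(1) M(1) M_eval by (rule isomorphism_linear_cp2)
  moreover have "linear_cp2 M (conj_cp2 p) = (linear_cp2 A \<circ> conj_cp2) (linear_cp2 M p)" for p
    by (simp add: conj_cp2_linear_cp2[OF M(1)] linear_cp2_mult[OF A' M'] flip: M(2))
  ultimately show ?thesis
    unfolding corresponding_real_form_def by blast
qed

lemmas matrix_3_simps = vec_eq_iff forall_3 matrix_matrix_mult_def matrix_vector_mult_def
  sum_3 cnj_matrix_def mat_def

text \<open>The test point is \<open>[0:1:0]\<close>, where the forms in \<open>Y1\<close> and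
  \<open>Y2\<close> of the three cases take the values 1, 1 and 2.\<close>

lemma squarefree_ternary:
  assumes "d > 0" "a \<noteq> 0" "euler_deriv 1 R = 0" "peval R (axis 2 1) \<noteq> 0"
  shows "squarefree (pconst a * Y0 ^ d + R)"
  using assms by (rule squarefree_pvar_power_add) (simp add: axis_def)

section \<open>The three cocycles\<close>

lemma real_form_K03:
  assumes "d > 0"
  shows "corresponding_real_form d (linear_cp2 K03) (Y0 ^ d + Y1 ^ d + Y2 ^ d)"
proof (rule corresponding_real_form_linear[where M = "mat 1" and N = "mat 1"])
  have "squarefree (pconst 1 * Y0 ^ d + (Y1 ^ d + Y2 ^ d))"
    using assms by (intro squarefree_ternary)
      (simp_all add: euler_deriv_add euler_deriv_power_eq_0 euler_deriv_pvar_other axis_def zero_power)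
  then show "squarefree (Y0 ^ d + Y1 ^ d + Y2 ^ d)"
    by (simp add: pconst_1 add.assoc)
qed (auto simp: K03_def cnj_matrix_mat_1 intro!: homogeneous_intros real_coeffs_intros)

text \<open>Any square root of \<xi> has \<open>d\<close>-th power 1 or -1. For even
  \<open>d\<close> this power is \<open>\<xi> ^ (d div 2)\<close>, which primitivity keeps away from
  1; for odd \<open>d\<close> the sign of the root can be switched.\<close>

lemma primitive_root_sqrt:
  assumes "d > 0" "primitive_root_of_unity d \<xi>"
  obtains \<eta> where "\<eta> ^ 2 = \<xi>" "\<eta> ^ d = -1"
proof -
  define \<eta> where "\<eta> = csqrt \<xi>"
  have \<eta>: "\<eta> ^ 2 = \<xi>"
    by (simp add: \<eta>_def)
  have "(\<eta> ^ d) ^ 2 = 1"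
    using assms(2) by (metis \<eta> power_mult mult.commute primitive_root_of_unity_def)
  then have cases: "\<eta> ^ d = 1 \<or> \<eta> ^ d = -1"
    by (simp add: power2_eq_1_iff)
  show ?thesis
  proof (cases "even d")
    case True
    then obtain e where e: "d = 2 * e"
      by blast
    then have "\<xi> ^ e \<noteq> 1"
      using assms by (simp add: primitive_root_of_unity_def)
    moreover have "\<eta> ^ d = \<xi> ^ e"
      by (simp add: e power_mult \<eta>)
    ultimately show ?thesis
      using cases \<eta> that by auto
  next
    case False
    then have "(- \<eta>) ^ 2 = \<xi>" "(- \<eta>) ^ d = - (\<eta> ^ d)"
      using \<eta> by simp_all
    then show ?thesis
      using cases \<eta> that[of \<eta>] that[of "- \<eta>"] by auto
  qed
qed

lemma mult_cnj_root_of_unity: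
  fixes z :: complex
  assumes "z ^ n = 1" "n > 0"
  shows "z * cnj z = 1"
proof -
  have "norm z = 1"
    using power_eq_1_iff[OF assms(1)] assms(2) by simp
  then show ?thesis
    using complex_norm_square[of z] by simp
qed

lemma real_form_K12:
  assumes "d > 0" "primitive_root_of_unity d \<xi>"
  shows "corresponding_real_form d (linear_cp2 (K12 \<xi>)) (- (Y0 ^ d) + Y1 ^ d + Y2 ^ d)"
proof -
  obtain \<eta> where \<eta>: "\<eta> ^ 2 = \<xi>" "\<eta> ^ d = -1"
    using assms by (rule primitive_root_sqrt)
  have \<xi>: "\<xi> ^ d = 1"
    using assms(2) by (simp add: primitive_root_of_unity_def)
  have "\<eta> ^ (2 * d) = 1"
    using \<eta>(1) \<xi> by (simp add: power_mult)
  then have \<eta>_cnj: "\<eta> * cnj \<eta> = 1"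
    using assms(1) mult_cnj_root_of_unity[of \<eta> "2 * d"] by simp
  \<comment> \<open>This is the nontrivial diagonal entry of \<open>M = A ** cnj_matrix M\<close>:
    multiply \<open>\<eta> * cnj \<eta> = 1\<close> by \<eta>.\<close>
  then have \<xi>_cnj: "\<eta> = \<xi> * cnj \<eta>"
    using \<eta>(1) by (metis mult.assoc mult.right_neutral power2_eq_square)
  show ?thesis
  proof (rule corresponding_real_form_linear[where M = "K12 \<eta>" and N = "K12 (cnj \<eta>)"])
    show "K12 \<xi> ** cnj_matrix (K12 \<xi>) = mat 1"
      using mult_cnj_root_of_unity[OF \<xi> assms(1)] by (simp add: matrix_3_simps K12_def)
    show "K12 (cnj \<eta>) ** K12 \<eta> = mat 1"
      using \<eta>_cnj by (simp add: matrix_3_simps K12_def mult.commute)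
    show "K12 \<eta> = K12 \<xi> ** cnj_matrix (K12 \<eta>)"
      using \<xi>_cnj by (simp add: matrix_3_simps K12_def)
    show "peval (Y0 ^ d + Y1 ^ d + Y2 ^ d) (K12 \<xi> *v v) = peval (Y0 ^ d + Y1 ^ d + Y2 ^ d) v" for v
      by (simp add: matrix_3_simps K12_def power_mult_distrib \<xi>)
    show "peval (Y0 ^ d + Y1 ^ d + Y2 ^ d) (K12 \<eta> *v v) = peval (- (Y0 ^ d) + Y1 ^ d + Y2 ^ d) v" for v
      by (simp add: matrix_3_simps K12_def power_mult_distrib \<eta>)
    have "squarefree (pconst (- 1) * Y0 ^ d + (Y1 ^ d + Y2 ^ d))"
      using assms by (intro squarefree_ternary)
        (simp_all add: euler_deriv_add euler_deriv_power_eq_0 euler_deriv_pvar_other axis_def zero_power)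
    moreover have "pconst (- 1) = - 1"
      by (simp add: pconst_def single_uminus)
    ultimately show "squarefree (- (Y0 ^ d) + Y1 ^ d + Y2 ^ d)"
      by (simp add: algebra_simps)
  qed (intro homogeneous_intros real_coeffs_intros)+
qed

lemma real_form_K01:
  assumes "d > 0"
  shows "corresponding_real_form d (linear_cp2 K01)
    (Y0 ^ d + (Y1 + pconst \<i> * Y2) ^ d + (Y1 - pconst \<i> * Y2) ^ d)"
proof -
  \<comment> \<open>Conjugation swaps the last two rows of \<open>M\<close>, and \<open>K01\<close>
    swaps them back. The matrix \<open>N\<close> recovers \<open>Y1\<close> as half the sum and
    \<open>Y2\<close> as the difference divided by \<open>2 * \<i>\<close>.\<close>
  define M :: "complex^3^3" where
    "M = vector [vector [1, 0, 0], vector [0, 1, \<i>], vector [0, 1, - \<i>]]"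
  define N :: "complex^3^3" where
    "N = vector [vector [1, 0, 0], vector [0, 1/2, 1/2], vector [0, - \<i>/2, \<i>/2]]"
  let ?L = "Y1 + pconst \<i> * Y2" and ?L' = "Y1 - pconst \<i> * Y2"
  show ?thesis
  proof (rule corresponding_real_form_linear[where M = M and N = N])
    show "K01 ** cnj_matrix K01 = mat 1"
      by (simp add: matrix_3_simps K01_def)
    show "N ** M = mat 1"
      by (simp add: matrix_3_simps M_def N_def)
    show "M = K01 ** cnj_matrix M"
      by (simp add: matrix_3_simps M_def K01_def)
    show "peval (Y0 ^ d + Y1 ^ d + Y2 ^ d) (K01 *v v) = peval (Y0 ^ d + Y1 ^ d + Y2 ^ d) v" for v
      by (simp add: matrix_3_simps K01_def)
    show "peval (Y0 ^ d + Y1 ^ d + Y2 ^ d) (M *v v) = peval (Y0 ^ d + ?L ^ d + ?L' ^ d) v" for v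
      by (simp add: matrix_3_simps M_def)
    have "squarefree (pconst 1 * Y0 ^ d + (?L ^ d + ?L' ^ d))"
      using assms by (intro squarefree_ternary)
        (simp_all add: euler_deriv_add euler_deriv_diff euler_deriv_mult euler_deriv_pconst
          euler_deriv_power_eq_0 euler_deriv_pvar_other axis_def zero_power)
    then show "squarefree (Y0 ^ d + ?L ^ d + ?L' ^ d)"
      by (simp add: pconst_1 add.assoc)
    \<comment> \<open>The conjugate linear forms have real sum \<open>2 * Y1\<close> and real
      product \<open>Y1 ^ 2 + Y2 ^ 2\<close>.\<close>
    have "real_coeffs (?L ^ d + ?L' ^ d)"
    proof (rule real_coeffs_power_sum)
      have "?L + ?L' = Y1 + Y1"
        by simp
      then show "real_coeffs (?L + ?L')"
        using real_coeffs_add[OF real_coeffs_pvar real_coeffs_pvar] by (rule ssubst)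
      have "pconst \<i> * pconst \<i> = - 1"
        by (simp add: pconst_def mult_single single_uminus)
      moreover have "?L * ?L' = Y1 * Y1 - (pconst \<i> * pconst \<i>) * (Y2 * Y2)"
        by (simp add: algebra_simps)
      ultimately have "?L * ?L' = Y1 * Y1 + Y2 * Y2"
        by simp
      then show "real_coeffs (?L * ?L')"
        by (simp add: real_coeffs_add real_coeffs_mult real_coeffs_pvar)
    qed
    then show "real_coeffs (Y0 ^ d + ?L ^ d + ?L' ^ d)"
      by (simp add: add.assoc real_coeffs_add real_coeffs_power real_coeffs_pvar)
  qed (intro homogeneous_intros)
qed

theorem theorem6p2:
  fixes d :: nat and \<xi> :: complex
  assumes "d \<ge> 3" and "primitive_root_of_unity d \<xi>"
  shows "corresponding_real_form d (linear_cp2 K03) (Y0 ^ d + Y1 ^ d + Y2 ^ d) \<and>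
         corresponding_real_form d (linear_cp2 (K12 \<xi>)) (- (Y0 ^ d) + Y1 ^ d + Y2 ^ d) \<and>
         corresponding_real_form d (linear_cp2 K01)
           (Y0 ^ d + (Y1 + pconst \<i> * Y2) ^ d + (Y1 - pconst \<i> * Y2) ^ d)"
  using assms by (intro conjI real_form_K03 real_form_K12 real_form_K01) simp_all

end
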